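(* Let $n\ge 1$, let $\lambda=(\lambda_1,\ldots,\lambda_n)\in\mathbb{R}^n$ with $0<\lambda_1<\cdots<\lambda_n$, let $(\mathfrak{g}_\lambda,[\;,\;])$ be the associated oscillator Lie algebra, and let $\circ:\mathfrak{g}_\lambda\otimes\mathfrak{g}_\lambda\to\mathfrak{g}_\lambda$ be a product such that $(\mathfrak{g}_\lambda,[\;,\;],\circ)$ is a Poisson algebra. Then there exists $c\in\mathbb{R}$ such that $$e_{-1}\circ e_{-1}=c\,e_0$$ and all the other products $\circ$ of two elements of the basis $\{e_{-1},e_0,e_i,\check e_i\}_{i=1,\ldots,n}$ are zero. Moreover, $\mathfrak{g}_\lambda$ endowed with the product $$u.v=[u,v]+u\circ v,\qquad u,v\in\mathfrak{g}_\lambda,$$ is a symmetric Leibniz algebra, and $\mathbf{k}_\lambda$ is invariant with respect to this product, i.e., for all $u,v,w\in\mathfrak{g}_\lambda$, $$\mathbf{k}_\lambda(u.v,w)=\mathbf{k}_\lambda(u,v.w).$$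
   Context: Oscillator Lie algebra: for $n\ge1$ and $\lambda=(\lambda_1,\ldots,\lambda_n)\in\mathbb{R}^n$ with $0<\lambda_1\le\cdots\le\lambda_n$, $\mathfrak{g}_\lambda$ is the real Lie algebra of dimension $2n+2$ with basis $\{e_{-1},e_0,e_i,\check e_i\}_{i=1,\ldots,n}$ and brackets $$[e_{-1},e_i]=\lambda_i\check e_i,\qquad [e_{-1},\check e_i]=-\lambda_i e_i,\qquad [e_i,\check e_i]=e_0,\qquad i=1,\ldots,n,$$ the unspecified brackets of basis elements being given by antisymmetry or zero. $\mathbf{k}_\lambda$ is the symmetric bilinear form on $\mathfrak{g}_\lambda$ whose quadratic form is $\mathbf{k}_\lambda(x,x)=2x_{-1}x_0+\sum_{j=1}^n\frac1{\lambda_j}(x_j^2+\check x_j^2)$ for $x=x_{-1}e_{-1}+x_0e_0+\sum_{i=1}^n(x_ie_i+\check x_i\check e_i)$. Poisson algebra: a finite dimensional Lie algebra $(\mathfrak{g},[\;,\;])$ endowed with a commutative and associative bilinear product $\circ$ (no unit required) such that $[u,v\circ w]=[u,v]\circ w+v\circ[u,w]$ for all $u,v,w\in\mathfrak{g}$. Symmetric Leibniz algebra: an algebra $(A,.)$ in which all left and right multiplications are derivations, i.e., for all $u,v,w\in A$, $u.(v.w)=(u.v).w+v.(u.w)$ and $(v.w).u=(v.u).w+v.(w.u)$. *)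

theory Defs
  imports "HOL-Analysis.Analysis"
begin

definition lie_algebra :: "('a::euclidean_space \<Rightarrow> 'a \<Rightarrow> 'a) \<Rightarrow> bool" where
  "lie_algebra br \<longleftrightarrow>
     bilinear br \<and>
     (\<forall>x. br x x = 0) \<and>
     (\<forall>x y z. br x (br y z) + br y (br z x) + br z (br x y) = 0)"

definition poisson_algebra ::
  "('a::euclidean_space \<Rightarrow> 'a \<Rightarrow> 'a) \<Rightarrow> ('a \<Rightarrow> 'a \<Rightarrow> 'a) \<Rightarrow> bool" where
  "poisson_algebra br op \<longleftrightarrow>
     lie_algebra br \<and>
     bilinear op \<and>
     (\<forall>u v. op u v = op v u) \<and>
     (\<forall>u v w. op (op u v) w = op u (op v w)) \<and>
     (\<forall>u v w. br u (op v w) = op (br u v) w + op v (br u w))"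

definition symmetric_leibniz_algebra :: "('a::real_vector \<Rightarrow> 'a \<Rightarrow> 'a) \<Rightarrow> bool" where
  "symmetric_leibniz_algebra m \<longleftrightarrow>
     bilinear m \<and>
     (\<forall>u v w. m u (m v w) = m (m u v) w + m v (m u w)) \<and>
     (\<forall>u v w. m (m v w) u = m (m v u) w + m v (m w u))"

text \<open>
  The labels of the basis vectors of the oscillator algebra: \<open>Im1\<close>, \<open>I0\<close>, \<open>I i\<close>, \<open>Ic i\<close> stand
  for \<open>-1\<close>, \<open>0\<close>, \<open>i\<close> and \<open>i\<close> with a check accent.  The type \<open>'n\<close> plays the role of
  \<open>{1, ..., n}\<close>, so \<open>n = CARD('n) \<ge> 1\<close>.
\<close>

datatype 'n osc_index = Im1 | I0 | I 'n | Ic 'n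

instance osc_index :: (finite) finite
proof
  have "a \<in> {Im1, I0} \<union> range I \<union> range Ic" for a :: "'a osc_index"
    by (cases a) simp_all
  then have U: "(UNIV :: 'a osc_index set) = {Im1, I0} \<union> range I \<union> range Ic"
    by blast
  show "finite (UNIV :: 'a osc_index set)"
    unfolding U by simp
qed

type_synonym 'n osc = "real ^ ('n osc_index)"

abbreviation osc_basis :: "'n::finite osc_index \<Rightarrow> 'n osc" where
  "osc_basis a \<equiv> axis a 1"

fun osc_basis_bracket ::
  "real ^ 'n::finite \<Rightarrow> 'n osc_index \<Rightarrow> 'n osc_index \<Rightarrow> 'n osc" where
  "osc_basis_bracket l Im1 (I i) = (l $ i) *\<^sub>R osc_basis (Ic i)"
| "osc_basis_bracket l (I i) Im1 = - ((l $ i) *\<^sub>R osc_basis (Ic i))"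
| "osc_basis_bracket l Im1 (Ic i) = - ((l $ i) *\<^sub>R osc_basis (I i))"
| "osc_basis_bracket l (Ic i) Im1 = (l $ i) *\<^sub>R osc_basis (I i)"
| "osc_basis_bracket l (I i) (Ic j) = (if i = j then osc_basis I0 else 0)"
| "osc_basis_bracket l (Ic i) (I j) = (if i = j then - osc_basis I0 else 0)"
| "osc_basis_bracket l _ _ = 0"

definition osc_bracket :: "real ^ 'n::finite \<Rightarrow> 'n osc \<Rightarrow> 'n osc \<Rightarrow> 'n osc" where
  "osc_bracket l x y = (\<Sum>a\<in>UNIV. \<Sum>b\<in>UNIV. (x $ a * y $ b) *\<^sub>R osc_basis_bracket l a b)"

text \<open>The polarization of the quadratic form; see \<open>osc_form_quadratic\<close> below.\<close>

definition osc_form :: "real ^ 'n::finite \<Rightarrow> 'n osc \<Rightarrow> 'n osc \<Rightarrow> real" where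
  "osc_form l x y =
     x $ Im1 * y $ I0 + x $ I0 * y $ Im1 +
     (\<Sum>j\<in>UNIV. 1 / l $ j * (x $ I j * y $ I j + x $ Ic j * y $ Ic j))"

lemma osc_form_quadratic:
  "osc_form l x x =
     2 * x $ Im1 * x $ I0 + (\<Sum>j\<in>UNIV. 1 / l $ j * ((x $ I j)\<^sup>2 + (x $ Ic j)\<^sup>2))"
  by (simp add: osc_form_def power2_eq_square)

lemma osc_form_commute: "osc_form l x y = osc_form l y x"
  by (simp add: osc_form_def mult.commute add.commute)

lemma bilinear_osc_form: "bilinear (osc_form l)"
proof -
  have lin: "linear (osc_form l x)" for x
  proof (rule linearI)
    show "osc_form l x (y + z) = osc_form l x y + osc_form l x z" for y z
      by (simp only: osc_form_def vector_add_component distrib_left sum.distrib add_ac)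
    show "osc_form l x (r *\<^sub>R y) = r *\<^sub>R osc_form l x y" for r y
      by (simp only: osc_form_def vector_scaleR_component real_scaleR_def distrib_left
          sum_distrib_left mult_ac)
  qed
  moreover have "(\<lambda>x. osc_form l x y) = osc_form l y" for y
    by (simp add: osc_form_commute fun_eq_iff)
  ultimately show ?thesis
    by (simp add: bilinear_def)
qed

lemma sum_osc_index:
  fixes f :: "'n::finite osc_index \<Rightarrow> 'b::comm_monoid_add"
  shows "(\<Sum>a\<in>UNIV. f a) = f Im1 + f I0 + (\<Sum>i\<in>UNIV. f (I i)) + (\<Sum>i\<in>UNIV. f (Ic i))"
proof -
  have "a \<in> insert Im1 (insert I0 (range I \<union> range Ic))" for a :: "'n osc_index"
    by (cases a) simp_all
  then have U: "(UNIV :: 'n osc_index set) = insert Im1 (insert I0 (range I \<union> range Ic))"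
    by blast
  have "sum f (range I \<union> range Ic) = sum f (range I) + sum f (range Ic)"
    by (rule sum.union_disjoint) auto
  then show ?thesis
    unfolding U by (simp add: sum.reindex inj_on_def image_iff add.assoc)
qed

lemma osc_bracket_basis:
  "osc_bracket l (osc_basis a) (osc_basis b) = osc_basis_bracket l a b"
proof -
  have "(osc_basis a $ a' * osc_basis b $ b') *\<^sub>R osc_basis_bracket l a' b' =
      (if a' = a then if b' = b then osc_basis_bracket l a' b' else 0 else 0)" for a' b'
    by (simp add: axis_def)
  then have "osc_bracket l (osc_basis a) (osc_basis b) =
      (\<Sum>a'\<in>UNIV. \<Sum>b'\<in>UNIV. if a' = a then if b' = b then osc_basis_bracket l a' b' else 0 else 0)"
    unfolding osc_bracket_def by simp
  also have "\<dots> = (\<Sum>a'\<in>UNIV. if a' = a then \<Sum>b'\<in>UNIV. if b' = b then osc_basis_bracket l a' b' else 0 else 0)"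
    by (rule sum.cong) auto
  finally show ?thesis by simp
qed

lemma bilinear_osc_bracket: "bilinear (osc_bracket l)"
  unfolding bilinear_def osc_bracket_def
  by (auto intro!: linearI
      simp: distrib_left distrib_right scaleR_add_left sum.distrib scaleR_sum_right mult_ac)

lemma osc_bracket_nth:
  "osc_bracket l x y $ Im1 = 0"
  "osc_bracket l x y $ I0 = (\<Sum>i\<in>UNIV. x $ I i * y $ Ic i - x $ Ic i * y $ I i)"
  "osc_bracket l x y $ I i = l $ i * (x $ Ic i * y $ Im1 - x $ Im1 * y $ Ic i)"
  "osc_bracket l x y $ Ic i = l $ i * (x $ Im1 * y $ I i - x $ I i * y $ Im1)"
proof -
  have if_nth: "(if P then u else 0) $ a = (if P then u $ a else 0)"
    for P and u :: "'a osc" and a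
    by simp
  have mult_if: "c * (if P then d else 0) = (if P then c * d else 0)" for P and c d :: real
    by simp
  note simps = osc_bracket_def sum_component vector_scaleR_component sum_osc_index
    if_nth mult_if axis_def sum_negf sum_subtractf
  show "osc_bracket l x y $ Im1 = 0"
    by (simp add: simps)
  show "osc_bracket l x y $ I0 = (\<Sum>i\<in>UNIV. x $ I i * y $ Ic i - x $ Ic i * y $ I i)"
    by (simp add: simps)
  show "osc_bracket l x y $ I i = l $ i * (x $ Ic i * y $ Im1 - x $ Im1 * y $ Ic i)"
    by (simp add: simps right_diff_distrib mult_ac)
  show "osc_bracket l x y $ Ic i = l $ i * (x $ Im1 * y $ I i - x $ I i * y $ Im1)"
    by (simp add: simps right_diff_distrib mult_ac)
qed

lemma lie_algebra_osc_bracket: "lie_algebra (osc_bracket l)"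
proof -
  have "osc_bracket l x x = 0" for x
  proof -
    have "osc_bracket l x x $ a = 0 $ a" for a
      by (cases a) (simp_all add: osc_bracket_nth)
    then show ?thesis by (simp add: vec_eq_iff)
  qed
  moreover have "osc_bracket l x (osc_bracket l y z) + osc_bracket l y (osc_bracket l z x)
      + osc_bracket l z (osc_bracket l x y) = 0" (is "?J = 0") for x y z
  proof -
    have "?J $ a = 0 $ a" for a
    proof (cases a)
      case I0
      have "?J $ I0 = (\<Sum>i\<in>UNIV.
          (x $ I i * (osc_bracket l y z $ Ic i) - x $ Ic i * (osc_bracket l y z $ I i)) +
          (y $ I i * (osc_bracket l z x $ Ic i) - y $ Ic i * (osc_bracket l z x $ I i)) +
          (z $ I i * (osc_bracket l x y $ Ic i) - z $ Ic i * (osc_bracket l x y $ I i)))"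
        by (simp only: vector_add_component osc_bracket_nth(2) sum.distrib)
      also have "\<dots> = 0"
        by (rule sum.neutral) (auto simp: osc_bracket_nth(3,4) algebra_simps)
      finally show ?thesis by (simp add: I0)
    qed (simp_all add: osc_bracket_nth algebra_simps)
    then show ?thesis by (simp add: vec_eq_iff)
  qed
  ultimately show ?thesis
    by (simp add: lie_algebra_def bilinear_osc_bracket)
qed

end

theory Submission
  imports Defs
begin

text \<open>
  Write \<open>P\<close>, \<open>z\<close>, \<open>e\<^sub>i\<close>, \<open>f\<^sub>i\<close> for the basis vectors labelled \<open>Im1\<close>, \<open>I0\<close>, \<open>I i\<close>, \<open>Ic i\<close>.
  Both \<open>P \<circ> P\<close> and \<open>P \<circ> z\<close> are killed by \<open>ad P\<close>, so
  \<open>P \<circ> P = m P + c z\<close> and \<open>P \<circ> z = \<alpha> P + \<beta> z\<close>. Applying \<open>ad e\<^sub>i\<close> and \<open>ad f\<^sub>i\<close> to these shows that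
  \<open>P\<close> and \<open>z\<close> multiply every \<open>e\<^sub>i\<close>, \<open>f\<^sub>i\<close> by \<open>m/2\<close> and \<open>\<alpha>\<close>. Computing \<open>f\<^sub>i \<circ> f\<^sub>i\<close> from
  \<open>[e\<^sub>i, P \<circ> f\<^sub>i]\<close> and applying \<open>ad e\<^sub>i\<close> once more gives \<open>\<alpha> = 0\<close>; associativity of \<open>P \<circ> P \<circ> e\<^sub>i\<close>
  and \<open>P \<circ> P \<circ> z\<close> then forces \<open>m = 0\<close> and \<open>\<beta> = 0\<close>. So \<open>P\<close> annihilates the derived ideal, and
  \<open>0 = [e\<^sub>j, P \<circ> w] = -\<lambda>\<^sub>j f\<^sub>j \<circ> w\<close> for \<open>w\<close> in it.
\<close>

text \<open>\<open>ad P\<close> acts on each plane spanned by \<open>e\<^sub>i\<close>,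
  \<open>f\<^sub>i\<close> as a quarter turn scaled by \<open>l $ i\<close>, hence
  injectively.\<close>

lemma osc_centralizer_Im1:
  fixes l :: "real ^ 'n::finite"
  assumes "\<forall>i. l $ i \<noteq> 0" "osc_bracket l (osc_basis Im1) x = 0"
  shows "x = (x $ Im1) *\<^sub>R osc_basis Im1 + (x $ I0) *\<^sub>R osc_basis I0"
proof -
  have "x $ I i = 0" "x $ Ic i = 0" for i
    using assms osc_bracket_nth(3,4)[of l "osc_basis Im1" x i]
    by (simp_all add: axis_def)
  then have "x $ a = ((x $ Im1) *\<^sub>R osc_basis Im1 + (x $ I0) *\<^sub>R osc_basis I0) $ a" for a
    by (cases a) (simp_all add: axis_def)
  then show ?thesis unfolding vec_eq_iff by blast
qed

lemma osc_poisson_products: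
  fixes l :: "real ^ 'n::finite"
  assumes nz: "\<forall>i. l $ i \<noteq> 0" and "poisson_algebra (osc_bracket l) op"
  shows "\<exists>c::real. op (osc_basis Im1) (osc_basis Im1) = c *\<^sub>R osc_basis I0 \<and>
    (\<forall>a b. (a, b) \<noteq> (Im1, Im1) \<longrightarrow> op (osc_basis a) (osc_basis b) = 0)"
proof -
  let ?P = "osc_basis Im1 :: 'n osc" and ?z = "osc_basis I0 :: 'n osc"
  let ?e = "\<lambda>i. osc_basis (I i) :: 'n osc" and ?f = "\<lambda>i. osc_basis (Ic i) :: 'n osc"
  let ?B = "osc_bracket l"
  have bil: "bilinear op" and comm: "op u v = op v u"
    and assoc: "op (op u v) w = op u (op v w)"
    and leib: "?B u (op v w) = op (?B u v) w + op v (?B u w)" for u v w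
    using assms(2) unfolding poisson_algebra_def by blast+
  note bB = bilinear_osc_bracket[of l]
  note lins = bilinear_ladd[OF bil] bilinear_radd[OF bil] bilinear_lmul[OF bil]
    bilinear_rmul[OF bil] bilinear_lneg[OF bil] bilinear_rneg[OF bil]
    bilinear_lzero[OF bil] bilinear_rzero[OF bil]
    bilinear_ladd[OF bB] bilinear_radd[OF bB] bilinear_lmul[OF bB]
    bilinear_rmul[OF bB] bilinear_lneg[OF bB] bilinear_rneg[OF bB]
    bilinear_lzero[OF bB] bilinear_rzero[OF bB] osc_bracket_basis
  have l0: "l $ i \<noteq> 0" for i using nz by simp
  define m c \<alpha> \<beta>
    where "m = op ?P ?P $ Im1" and "c = op ?P ?P $ I0"
      and "\<alpha> = op ?P ?z $ Im1" and "\<beta> = op ?P ?z $ I0"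
  have K: "?B ?P (op ?P ?P) = 0" "?B ?P (op ?P ?z) = 0"
    by (simp_all add: leib lins)
  have PP: "op ?P ?P = m *\<^sub>R ?P + c *\<^sub>R ?z"
    unfolding m_def c_def by (rule osc_centralizer_Im1[OF nz K(1)])
  have Pz: "op ?P ?z = \<alpha> *\<^sub>R ?P + \<beta> *\<^sub>R ?z"
    unfolding \<alpha>_def \<beta>_def by (rule osc_centralizer_Im1[OF nz K(2)])
  \<comment> \<open>A derivation hits both factors of \<open>P \<circ> P\<close>, giving two equal
    terms; hence the half.\<close>
  have half: "x = (m / 2) *\<^sub>R y"
    if "(m * l $ i) *\<^sub>R y = l $ i *\<^sub>R x + l $ i *\<^sub>R x" for i and x y :: "'n osc"
  proof -
    have "l $ i *\<^sub>R (2 *\<^sub>R x) = l $ i *\<^sub>R (m *\<^sub>R y)"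
      using that by (simp add: scaleR_2 scaleR_add_right mult.commute)
    then have "2 *\<^sub>R x = m *\<^sub>R y"
      using l0[of i] by (simp only: scaleR_cancel_left) simp
    then have "(1 / 2) *\<^sub>R (2 *\<^sub>R x) = (1 / 2) *\<^sub>R (m *\<^sub>R y)"
      by simp
    then show ?thesis by simp
  qed
  \<comment> \<open>The sign in \<open>- ?e i\<close> is there because
    \<open>[e\<^sub>i, P] = -\<lambda>\<^sub>i f\<^sub>i\<close>.\<close>
  have Pf: "op ?P (?f i) = (m / 2) *\<^sub>R ?f i" for i
    by (rule half[of i]) (use leib[of "- ?e i" ?P ?P] in \<open>simp add: PP lins comm[of "?f i" ?P]\<close>)
  have Pe: "op ?P (?e i) = (m / 2) *\<^sub>R ?e i" for i
    by (rule half[of i]) (use leib[of "?f i" ?P ?P] in \<open>simp add: PP lins comm[of "?e i" ?P]\<close>)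
  have cancel: "x = \<alpha> *\<^sub>R y" if "(\<alpha> * l $ i) *\<^sub>R y = l $ i *\<^sub>R x" for i and x y :: "'n osc"
  proof -
    have "l $ i *\<^sub>R x = l $ i *\<^sub>R (\<alpha> *\<^sub>R y)"
      using that by (simp add: mult.commute)
    then show ?thesis
      using l0[of i] by (simp only: scaleR_cancel_left) simp
  qed
  have zf: "op ?z (?f i) = \<alpha> *\<^sub>R ?f i" for i
    by (rule cancel[of i]) (use leib[of "- ?e i" ?P ?z] in \<open>simp add: Pz lins comm[of "?f i" ?z]\<close>)
  have ze: "op ?z (?e i) = \<alpha> *\<^sub>R ?e i" for i
    by (rule cancel[of i]) (use leib[of "?f i" ?P ?z] in \<open>simp add: Pz lins comm[of "?e i" ?z]\<close>)
  \<comment> \<open>A single index, available as \<open>n \<ge> 1\<close>, determines the scalars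
    \<alpha>, \<open>m\<close> and \<beta>.\<close>
  fix i0 :: 'n
  have ff: "l $ i0 *\<^sub>R op (?f i0) (?f i0) = \<alpha> *\<^sub>R ?P + (\<beta> - m / 2) *\<^sub>R ?z"
    using leib[of "?e i0" ?P "?f i0"] by (simp add: Pz Pf lins algebra_simps)
  have "?B (?e i0) (l $ i0 *\<^sub>R op (?f i0) (?f i0)) = (2 * l $ i0 * \<alpha>) *\<^sub>R ?f i0"
    by (simp add: lins leib zf comm[of "?f i0" ?z] flip: scaleR_add_left)
  \<comment> \<open>The coefficients of \<open>f\<close> on the two sides read
    \<open>-l \<alpha> = 2 l \<alpha>\<close>.\<close>
  then have "?B (?e i0) (\<alpha> *\<^sub>R ?P + (\<beta> - m / 2) *\<^sub>R ?z) $ Ic i0 =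
      ((2 * l $ i0 * \<alpha>) *\<^sub>R ?f i0) $ Ic i0"
    unfolding ff by simp
  then have \<alpha>: "\<alpha> = 0"
    using l0[of i0] by (auto simp: lins)
  \<comment> \<open>With \<alpha> zero this compares \<open>m * m / 2\<close> with
    \<open>m * m / 4\<close>.\<close>
  have "op (op ?P ?P) (?e i0) = op ?P (op ?P (?e i0))"
    by (rule assoc)
  then have m: "m = 0"
    by (simp add: PP Pe lins ze \<alpha> axis_eq_0_iff)
  have zz: "op ?z ?z = 0"
    using leib[of "?e i0" ?z "?f i0"] by (simp add: zf \<alpha> lins)
  \<comment> \<open>The left side is now \<open>c (z \<circ> z) = 0\<close>, the right side
    \<open>\<beta> * \<beta>\<close> times \<open>z\<close>.\<close>
  have "op (op ?P ?P) ?z = op ?P (op ?P ?z)"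
    by (rule assoc)
  then have \<beta>: "\<beta> = 0"
    by (auto simp: PP Pz lins zz m \<alpha> axis_eq_0_iff)
  have P0: "op ?P (osc_basis a) = 0" if "a \<noteq> Im1" for a
    using that by (cases a) (simp_all add: Pz Pe Pf \<alpha> \<beta> m)
  \<comment> \<open>These brackets are multiples of \<open>z\<close>, which \<open>P\<close>
    annihilates.\<close>
  have ad0: "op ?P (?B (?e j) (osc_basis a)) = 0" "op ?P (?B (?f j) (osc_basis a)) = 0"
    if "a \<noteq> Im1" for a j
    using that by (cases a; simp add: lins P0)+
  have "op (?f j) (osc_basis a) = 0" "op (?e j) (osc_basis a) = 0" if "a \<noteq> Im1" for a j
    using leib[of "?e j" ?P "osc_basis a"] leib[of "?f j" ?P "osc_basis a"] l0[of j] that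
    by (simp_all add: P0 ad0) (simp_all add: lins)
  then have "op (osc_basis a) (osc_basis b) = 0" if "(a, b) \<noteq> (Im1, Im1)" for a b
    using that P0[of a] P0[of b] zz ze zf \<alpha>
    by (cases a; cases b)
      (simp_all add: comm[of "?e i" ?P for i] comm[of "?f i" ?P for i] comm[of ?z ?P]
        comm[of "?e i" ?z for i] comm[of "?f i" ?z for i])
  then show ?thesis
    using PP m by auto
qed

theorem theorem3p1:
  fixes l :: "real ^ 'n::{finite,linorder}"
    and op :: "'n osc \<Rightarrow> 'n osc \<Rightarrow> 'n osc"
  assumes "\<forall>i. 0 < l $ i"
    and "strict_mono (\<lambda>i. l $ i)"
    and "poisson_algebra (osc_bracket l) op"
  shows "(\<exists>c::real. op (osc_basis Im1) (osc_basis Im1) = c *\<^sub>R osc_basis I0 \<and>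
            (\<forall>a b. (a, b) \<noteq> (Im1, Im1) \<longrightarrow> op (osc_basis a) (osc_basis b) = 0)) \<and>
         symmetric_leibniz_algebra (\<lambda>u v. osc_bracket l u v + op u v) \<and>
         (\<forall>u v w. osc_form l (osc_bracket l u v + op u v) w
                  = osc_form l u (osc_bracket l v w + op v w))"
proof -
  let ?B = "osc_bracket l"
  have nz: "\<forall>i. l $ i \<noteq> 0"
    using assms(1) by (metis less_irrefl)
  have ex: "\<exists>c::real. op (osc_basis Im1) (osc_basis Im1) = c *\<^sub>R osc_basis I0 \<and>
      (\<forall>a b. (a, b) \<noteq> (Im1, Im1) \<longrightarrow> op (osc_basis a) (osc_basis b) = 0)"
    using osc_poisson_products[OF nz assms(3)] .
  then obtain c :: real where c: "op (osc_basis Im1) (osc_basis Im1) = c *\<^sub>R osc_basis I0"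
    and c0: "\<And>a b. (a, b) \<noteq> (Im1, Im1) \<Longrightarrow> op (osc_basis a) (osc_basis b) = 0"
    by blast
  have bil: "bilinear op"
    using assms(3) by (simp add: poisson_algebra_def)
  note bB = bilinear_osc_bracket[of l]
  \<comment> \<open>Bilinearity turns the table on the basis into a closed formula for
    \<open>op\<close>.\<close>
  have "bilinear (\<lambda>u v :: 'n osc. (c * u $ Im1 * v $ Im1) *\<^sub>R (osc_basis I0 :: 'n osc))"
    unfolding bilinear_def by (auto intro!: linearI simp: algebra_simps)
  then have "op = (\<lambda>u v. (c * u $ Im1 * v $ Im1) *\<^sub>R osc_basis I0)"
  proof (rule bilinear_eq_stdbasis[OF bil])
    fix u v :: "'n osc"
    assume "u \<in> Basis" "v \<in> Basis"
    then obtain a b where "u = osc_basis a" "v = osc_basis b"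
      by (auto simp: Basis_vec_def)
    then show "op u v = (c * u $ Im1 * v $ Im1) *\<^sub>R osc_basis I0"
      using c c0[of a b] by (cases "(a, b) = (Im1, Im1)") (auto simp: axis_def)
  qed
  then have op: "op u v = (c * u $ Im1 * v $ Im1) *\<^sub>R osc_basis I0" for u v
    by simp
  have central: "?B u (osc_basis I0) = 0" "?B (osc_basis I0) u = 0" for u
  proof -
    have "?B u (osc_basis I0) $ a = 0 $ a" "?B (osc_basis I0) u $ a = 0 $ a" for a
      by (cases a; simp add: osc_bracket_nth axis_def)+
    then show "?B u (osc_basis I0) = 0" "?B (osc_basis I0) u = 0"
      by (simp_all add: vec_eq_iff)
  qed
  have anti: "?B u v = - ?B v u" for u v
  proof -
    have "?B u v $ a = (- ?B v u) $ a" for a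
      by (cases a) (simp_all add: osc_bracket_nth algebra_simps flip: sum_negf)
    then show ?thesis by (simp add: vec_eq_iff)
  qed
  have jac: "?B u (?B v w) + ?B v (?B w u) + ?B w (?B u v) = 0" for u v w
    using lie_algebra_osc_bracket[of l] by (simp add: lie_algebra_def)
  have jacobi: "?B u (?B v w) = ?B (?B u v) w + ?B v (?B u w)" for u v w
  proof -
    have *: "?B v (?B w u) = - ?B v (?B u w)"
      unfolding anti[of w u] by (rule bilinear_rneg[OF bB])
    show ?thesis
      using jac[of u v w] unfolding anti[of w "?B u v"] * by (simp add: algebra_simps)
  qed
  have z_Im1: "(osc_basis I0 :: 'n osc) $ Im1 = 0"
    by (simp add: axis_def)
  \<comment> \<open>Values of \<open>op\<close> are multiples of \<open>z\<close>, which is central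
    and annihilated by \<open>op\<close>; brackets have no \<open>Im1\<close> coordinate, so
    \<open>op\<close> kills them too. Both Leibniz identities thus reduce to Jacobi.\<close>
  have prod: "?B u (?B v w + op v w) + op u (?B v w + op v w) = ?B u (?B v w)"
    "?B (?B v w + op v w) u + op (?B v w + op v w) u = ?B (?B v w) u" for u v w
    by (simp_all add: op bilinear_radd[OF bB] bilinear_rmul[OF bB] bilinear_ladd[OF bB]
        bilinear_lmul[OF bB] central osc_bracket_nth(1) z_Im1)
  have bil_prod: "bilinear (\<lambda>u v. ?B u v + op u v)"
    using bil bB unfolding bilinear_def by (auto intro: linear_compose_add)
  have jacobi': "?B (?B v w) u = ?B (?B v u) w + ?B v (?B w u)" for u v w
    unfolding jacobi[of v w u] anti[of w "?B v u"] by simp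
  have sl: "symmetric_leibniz_algebra (\<lambda>u v. ?B u v + op u v)"
    unfolding symmetric_leibniz_algebra_def prod by (intro conjI allI bil_prod jacobi jacobi')
  have "osc_form l (?B u v + op u v) w = osc_form l u (?B v w + op v w)" for u v w
  proof -
    \<comment> \<open>The weights of the form cancel the factors \<open>l $ i\<close> of the
      bracket.\<close>
    have inv: "1 / l $ i * (l $ i * p * q + l $ i * r * s) = p * q + r * s"
      "1 / l $ i * (p * (l $ i * q) + r * (l $ i * s)) = p * q + r * s" for i and p q r s :: real
      using nz by (simp_all add: field_simps)
    have nth: "(osc_basis I0 :: 'n osc) $ I0 = 1" "(osc_basis I0 :: 'n osc) $ I i = 0"
      "(osc_basis I0 :: 'n osc) $ Ic i = 0" for i
      by (simp_all add: axis_def)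
    note form_simps = osc_form_def op vector_add_component vector_scaleR_component real_scaleR_def
      osc_bracket_nth nth z_Im1 inv mult_zero_left mult_zero_right mult_1_right add_0_left add_0_right
    note distribs = sum.distrib sum_distrib_left sum_distrib_right distrib_left distrib_right
      add_ac mult_ac
    \<comment> \<open>Each summand is the determinant of the \<open>Im1\<close>, \<open>I i\<close>,
      \<open>Ic i\<close> coordinates of \<open>u\<close>, \<open>v\<close>, \<open>w\<close>,
      expanded here along \<open>w\<close> and next along \<open>u\<close>.\<close>
    have "osc_form l (?B u v + op u v) w = c * u $ Im1 * v $ Im1 * w $ Im1 +
        (\<Sum>i\<in>UNIV. (u $ I i * v $ Ic i - u $ Ic i * v $ I i) * w $ Im1 +
          ((u $ Ic i * v $ Im1 - u $ Im1 * v $ Ic i) * w $ I i +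
           (u $ Im1 * v $ I i - u $ I i * v $ Im1) * w $ Ic i))"
      by (simp only: form_simps) (simp only: distribs)
    also have "\<dots> = c * u $ Im1 * v $ Im1 * w $ Im1 +
        (\<Sum>i\<in>UNIV. u $ Im1 * (v $ I i * w $ Ic i - v $ Ic i * w $ I i) +
          (u $ I i * (v $ Ic i * w $ Im1 - v $ Im1 * w $ Ic i) +
           u $ Ic i * (v $ Im1 * w $ I i - v $ I i * w $ Im1)))"
      by (rule arg_cong2[where f = "(+)", OF refl], rule sum.cong) (simp_all add: algebra_simps)
    also have "\<dots> = osc_form l u (?B v w + op v w)"
      by (simp only: form_simps) (simp only: distribs)
    finally show ?thesis .
  qed
  with ex sl show ?thesis by blast
qed

end
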